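(* Let $V_c=\{1,\dots,n\}$, let $G_c=(V_c,A_c)$ be a conflict graph with finite arc weights $s_{h,k}\ge 0$, and let $d_h\in\mathbb{R}$, $w_h\ge 0$, $c_h\in\mathbb{R}$, $\rho_h\in\mathbb{R}$ for $h\in V_c$. Let $(u_k^* )_{k\in V_c}$ be an optimal solution of problem $(P^D_1)$. Then $(u_k^* )_{k\in V_c}$ is also an optimal solution of each of the problems $(P^D_2)$, $(P^D_3)$ and $(P^D_4)$.
   Context: $V_c=\{1,\dots,n\}$ is a finite nonempty set (vehicles). $G_c=(V_c,A_c)$ is a finite directed graph (the conflict graph), possibly cyclic and/or disconnected, whose arcs join distinct vertices; each arc $(h,k)\in A_c$ carries a finite weight (slack) $s_{h,k}\ge 0$. For each $h\in V_c$, $d_h$ is the observed deviation (of any sign), $w_h$ a weight, $c_h$ the completion time in the nominal plan, $\rho_h$ a due date. The decision variables are $u_h\in\mathbb{R}$, $h\in V_c$. All four problems $(P^D_i)$, $i=1,\dots,4$, have the same constraints $$u_h-u_k\le s_{h,k}\quad (h,k)\in A_c,\qquad u_h\ge d_h\quad h\in V_c,$$ and $(P^D_i)$ asks to minimize $z_i$, where $z_1=\sum_{h\in V_c}u_h$, $z_2=\sum_{h\in V_c}w_hu_h$, $z_3=\max_{h\in V_c}(c_h+u_h)$, $z_4=\sum_{h\in V_c}\max(0,u_h-\rho_h)$. *)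

theory Defs
  imports
    Complex_Main
    "Graph_Theory.Pair_Digraph"
    "Graph_Theory.Weighted_Graph"
begin

definition feasible ::
  "'a pair_pre_digraph \<Rightarrow> ('a \<times> 'a) weight_fun \<Rightarrow> ('a \<Rightarrow> real) \<Rightarrow> ('a \<Rightarrow> real) \<Rightarrow> bool" where
  "feasible G s d u \<longleftrightarrow>
     (\<forall>(h, k) \<in> parcs G. u h - u k \<le> s (h, k)) \<and> (\<forall>h \<in> pverts G. u h \<ge> d h)"

definition z1 :: "'a set \<Rightarrow> ('a \<Rightarrow> real) \<Rightarrow> real" where
  "z1 V u = (\<Sum>h\<in>V. u h)"

definition z2 :: "'a set \<Rightarrow> ('a \<Rightarrow> real) \<Rightarrow> ('a \<Rightarrow> real) \<Rightarrow> real" where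
  "z2 V w u = (\<Sum>h\<in>V. w h * u h)"

(* Max is only meaningful for finite nonempty V. *)
definition z3 :: "'a set \<Rightarrow> ('a \<Rightarrow> real) \<Rightarrow> ('a \<Rightarrow> real) \<Rightarrow> real" where
  "z3 V c u = Max ((\<lambda>h. c h + u h) ` V)"

definition z4 :: "'a set \<Rightarrow> ('a \<Rightarrow> real) \<Rightarrow> ('a \<Rightarrow> real) \<Rightarrow> real" where
  "z4 V \<rho> u = (\<Sum>h\<in>V. max 0 (u h - \<rho> h))"

(* Candidates are functions on the whole type, but feasibility and the objectives
   z1 to z4 only depend on their values on the vertices of G. *)
definition optimal ::
  "'a pair_pre_digraph \<Rightarrow> ('a \<times> 'a) weight_fun \<Rightarrow> ('a \<Rightarrow> real) \<Rightarrow> (('a \<Rightarrow> real) \<Rightarrow> real) \<Rightarrow>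
   ('a \<Rightarrow> real) \<Rightarrow> bool" where
  "optimal G s d z u \<longleftrightarrow> is_arg_min z (feasible G s d) u"

end

theory Submission
  imports Defs
begin

text \<open>
  Feasibility consists of difference constraints and lower bounds, so it is preserved by pointwise
  minima. Replacing an optimal solution of the first problem by its minimum with another
  feasible solution cannot decrease the sum, hence it is the pointwise least feasible solution on
  the vertices, and it minimises every objective that is monotone in the values at the vertices.
\<close>

text \<open>On an arc \<open>(h, k)\<close>, whichever of \<open>u\<close> and \<open>v\<close>
  attains the minimum at \<open>k\<close> satisfies its own constraint there, and the minimum at
  \<open>h\<close> is at most its value at \<open>h\<close>.\<close>

lemma feasible_min:
  assumes "feasible G s d u" "feasible G s d v"
  shows "feasible G s d (\<lambda>h. min (u h) (v h))"
  using assms unfolding feasible_def by fastforce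

lemma optimal_z1_least:
  assumes "finite (pverts G)" "optimal G s d (z1 (pverts G)) u" "feasible G s d v"
    and "h \<in> pverts G"
  shows "u h \<le> v h"
proof (rule ccontr)
  assume less: "\<not> u h \<le> v h"
  let ?m = "\<lambda>h. min (u h) (v h)"
  have "feasible G s d ?m"
    using assms(2,3) by (auto simp: optimal_def is_arg_min_def intro: feasible_min)
  \<comment> \<open>No summand increases, and the one at \<open>h\<close> drops from
    \<open>u h\<close> to \<open>v h\<close>.\<close>
  moreover have "z1 (pverts G) ?m < z1 (pverts G) u"
    unfolding z1_def by (rule sum_strict_mono_ex1, use assms(1,4) less in \<open>auto intro!: bexI[of _ h]\<close>)
  ultimately show False
    using assms(2) by (auto simp: optimal_def is_arg_min_def)
qed

text \<open>By \<open>optimal_z1_least\<close>, every feasible \<open>v\<close> dominates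
  \<open>u\<close> on the vertices, so monotonicity of \<open>z\<close> is needed only upwards from
  this \<open>u\<close>.\<close>

lemma optimal_z1_imp_optimal:
  assumes "finite (pverts G)" "optimal G s d (z1 (pverts G)) u"
    and mono: "\<And>v. (\<And>h. h \<in> pverts G \<Longrightarrow> u h \<le> v h) \<Longrightarrow> z u \<le> z v"
  shows "optimal G s d z u"
proof -
  have "z u \<le> z v" if "feasible G s d v" for v
    using optimal_z1_least[OF assms(1,2) that] by (rule mono)
  then show ?thesis
    using assms(2) by (auto simp: optimal_def is_arg_min_linorder)
qed

lemma z2_mono:
  assumes "\<And>h. h \<in> V \<Longrightarrow> w h \<ge> 0" "\<And>h. h \<in> V \<Longrightarrow> u h \<le> v h"
  shows "z2 V w u \<le> z2 V w v"
  unfolding z2_def by (intro sum_mono mult_left_mono assms)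

lemma z3_mono:
  assumes "finite V" "V \<noteq> {}" "\<And>h. h \<in> V \<Longrightarrow> u h \<le> v h"
  shows "z3 V c u \<le> z3 V c v"
  unfolding z3_def
proof (rule Max.boundedI)
  fix x assume "x \<in> (\<lambda>h. c h + u h) ` V"
  then obtain h where "h \<in> V" "x = c h + u h" by blast
  then have "x \<le> c h + v h" using assms(3) by simp
  also have "\<dots> \<le> Max ((\<lambda>h. c h + v h) ` V)"
    using assms(1) \<open>h \<in> V\<close> by simp
  finally show "x \<le> Max ((\<lambda>h. c h + v h) ` V)" .
qed (use assms in auto)

lemma z4_mono:
  assumes "\<And>h. h \<in> V \<Longrightarrow> u h \<le> v h"
  shows "z4 V \<rho> u \<le> z4 V \<rho> v"
  unfolding z4_def by (intro sum_mono max.mono diff_right_mono order_refl assms)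

theorem proposition3:
  fixes n :: nat
    and G :: "nat pair_pre_digraph"
    and s :: "(nat \<times> nat) weight_fun"
    and d w c \<rho> u :: "nat \<Rightarrow> real"
  assumes "n \<ge> 1"
    and "pair_digraph G"
    and "pverts G = {1..n}"
    and "\<And>h k. (h, k) \<in> parcs G \<Longrightarrow> s (h, k) \<ge> 0"
    and "\<And>h. h \<in> pverts G \<Longrightarrow> w h \<ge> 0"
    and "optimal G s d (z1 (pverts G)) u"
  shows "optimal G s d (z2 (pverts G) w) u
       \<and> optimal G s d (z3 (pverts G) c) u
       \<and> optimal G s d (z4 (pverts G) \<rho>) u"
proof -
  have fin: "finite (pverts G)" and ne: "pverts G \<noteq> {}"
    using assms(1,3) by auto
  \<comment> \<open>Only monotonicity of each objective remains: \<open>w h \<ge> 0\<close> enters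
    through \<open>z2\<close>, nonemptiness through the \<open>Max\<close> in
    \<open>z3\<close>.\<close>
  note opt = optimal_z1_imp_optimal[OF fin assms(6)]
  show ?thesis
    by (intro conjI opt z2_mono z3_mono z4_mono fin ne assms(5))
qed

end
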